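(* Let $M=(\mathcal{S},\mathcal{A},r,p,p_0,\gamma)$ be an episodic MDP, $\mathcal{O}$ a set of Markov options with intra-option policies $\{\pi_o\}$ and termination functions $\{\beta_o\}$, and $\pi$ a master policy. Let $M^{\mathcal{H}}$, $\pi^{\mathcal{H}}$ (high-MDP and its policy) and $M^{\mathcal{L}}$, $\pi^{\mathcal{L}}$ (low-MDP and its policy) be the associated augmented MDPs and policies defined in the context. Then the expected discounted returns coincide: $$J \doteq \int r(\tau)\, p(\tau \mid \pi,\mathcal{O},M)\, d\tau = \int r(\tau^{\mathcal{H}})\, p(\tau^{\mathcal{H}} \mid \pi^{\mathcal{H}}, M^{\mathcal{H}})\, d\tau^{\mathcal{H}} = \int r(\tau^{\mathcal{L}})\, p(\tau^{\mathcal{L}} \mid \pi^{\mathcal{L}}, M^{\mathcal{L}})\, d\tau^{\mathcal{L}}.$$ Here the three integrals (sums, in the discrete setting) run over trajectories of $\{\pi,\mathcal{O},M\}$, of $\{\pi^{\mathcal{H}},M^{\mathcal{H}}\}$ and of $\{\pi^{\mathcal{L}},M^{\mathcal{L}}\}$ respectively.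
   Context: **MDP.** $\mathcal{S}$, $\mathcal{A}$ are countable state and action sets, $r:\mathcal{S}\times\mathcal{A}\to\mathbb{R}$ is a bounded reward function, $p(s'\mid s,a)$ is a transition kernel, $p_0$ is an initial distribution on $\mathcal{S}$, and $\gamma\in[0,1)$. The task is episodic: there is a set of terminal states, an episode stops at the first time $T$ at which a terminal state is reached, and $T<\infty$ with probability one under $\{\pi,\mathcal{O},M\}$. **Options and execution model.** $\mathcal{O}$ is a countable set of Markov options. Each $o\in\mathcal{O}$ can be initiated in every state and has an intra-option policy $\pi_o(\cdot\mid s)$ (a distribution on $\mathcal{A}$) and a termination function $\beta_o:\mathcal{S}\to[0,1]$. The master policy $\pi(\cdot\mid s)$ is a distribution on $\mathcal{O}$. Execution is call-and-return: $S_0\sim p_0$ and $O_0\sim\pi(\cdot\mid S_0)$. At each time $t\ge 1$, with probability $\beta_{O_{t-1}}(S_t)$ the previous option terminates and $O_t\sim\pi(\cdot\mid S_t)$; otherwise $O_t=O_{t-1}$. At each time $t\ge0$, $A_t\sim\pi_{O_t}(\cdot\mid S_t)$ and $S_{t+1}\sim p(\cdot\mid S_t,A_t)$, and a reward with mean $r(S_t,A_t)$ is received. Accordingly write $$p(s'\mid s,o)=\sum_a\pi_o(a\mid s)p(s'\mid s,a),\qquad p(o'\mid s,o)=(1-\beta_o(s))\mathbb{I}_{o=o'}+\beta_o(s)\pi(o'\mid s),$$ and $r(s,o)=\sum_a\pi_o(a\mid s)r(s,a)$. **High-MDP.** Let $\#$ be a dummy option and $\mathcal{O}^+=\mathcal{O}\cup\{\#\}$.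 $M^{\mathcal{H}}$ has state space $\mathcal{S}^{\mathcal{H}}=\mathcal{O}^+\times\mathcal{S}$, action space $\mathcal{A}^{\mathcal{H}}=\mathcal{O}$, discount $\gamma$, and - transition kernel $p^{\mathcal{H}}((o',s')\mid(o,s),a^{\mathcal{H}})=\mathbb{I}_{a^{\mathcal{H}}=o'}\,p(s'\mid s,o')$ for $o'\in\mathcal{O}$ (and $0$ for $o'=\#$); - initial distribution $p_0^{\mathcal{H}}((o,s))=p_0(s)\mathbb{I}_{o=\#}$; - reward $r^{\mathcal{H}}((o,s),o')=r(s,o')$. The policy is $\pi^{\mathcal{H}}(o'\mid(o,s))=p(o'\mid s,o)$ if $o\ne\#$, and $\pi^{\mathcal{H}}(o'\mid(\#,s))=\pi(o'\mid s)$. **Low-MDP.** $M^{\mathcal{L}}$ has state space $\mathcal{S}^{\mathcal{L}}=\mathcal{S}\times\mathcal{O}$, action space $\mathcal{A}^{\mathcal{L}}=\mathcal{A}$, discount $\gamma$, and - transition kernel $p^{\mathcal{L}}((s',o')\mid(s,o),a)=p(s'\mid s,a)\,p(o'\mid s',o)$; - initial distribution $p_0^{\mathcal{L}}((s,o))=p_0(s)\pi(o\mid s)$; - reward $r^{\mathcal{L}}((s,o),a)=r(s,a)$. The policy is $\pi^{\mathcal{L}}(a\mid(s,o))=\pi_o(a\mid s)$. In both augmented MDPs a state is terminal iff its $\mathcal{S}$-component is terminal in $M$. **Trajectories and returns.** A trajectory of $\{\pi,\mathcal{O},M\}$ is $\tau=(S_0,O_0,A_0,S_1,O_1,A_1,\dots,S_T,O_T)$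 stopped at the first terminal state $S_T$ (the option $O_T$ is drawn at $S_T$ by the same execution rule), with return $r(\tau)=\sum_{t=0}^{T-1}\gamma^t r(S_t,A_t)$. A trajectory of $\{\pi^{\mathcal{H}},M^{\mathcal{H}}\}$ is $\tau^{\mathcal{H}}=(S_0^{\mathcal{H}},A_0^{\mathcal{H}},\dots,S_T^{\mathcal{H}})$ stopped at the first terminal state, with $r(\tau^{\mathcal{H}})=\sum_{t=0}^{T-1}\gamma^t r^{\mathcal{H}}(S^{\mathcal{H}}_t,A^{\mathcal{H}}_t)$; similarly for $\tau^{\mathcal{L}}$ with superscript $\mathcal{L}$. $p(\tau\mid\cdot)$ denotes the probability of generating the trajectory under the indicated policy and (semi-)MDP. *)

theory Defs
  imports "HOL-Probability.Probability"
begin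

record ('s, 'a) mdp =
  initial :: "'s pmf"
  transition :: "'s \<Rightarrow> 'a \<Rightarrow> 's pmf"
  reward :: "'s \<Rightarrow> 'a \<Rightarrow> real"
  discount :: real
  terminal :: "'s set"

text \<open>Options are indexed by a type \<open>'w\<close>; every option may be initiated in every state.\<close>

record ('s, 'a, 'w) option_family =
  intra :: "'w \<Rightarrow> 's \<Rightarrow> 'a pmf"
  beta :: "'w \<Rightarrow> 's \<Rightarrow> real"

definition wf_mdp :: "('s, 'a) mdp \<Rightarrow> bool" where
  "wf_mdp M \<longleftrightarrow>
     (\<exists>B. \<forall>s a. \<bar>reward M s a\<bar> \<le> B) \<and> 0 \<le> discount M \<and> discount M < 1"

definition wf_option_family :: "('s, 'a, 'w) option_family \<Rightarrow> bool" where
  "wf_option_family F \<longleftrightarrow> (\<forall>w s. 0 \<le> beta F w s \<and> beta F w s \<le> 1)"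


section \<open>Trajectories of an MDP under a policy\<close>

text \<open>
  The sequence \<open>(S\<^sub>0, A\<^sub>0, \<dots>, S\<^sub>T)\<close> is represented by the list of the pairs \<open>(S\<^sub>t, A\<^sub>t)\<close>, \<open>t < T\<close>,
  together with \<open>S\<^sub>T\<close>.
\<close>

type_synonym ('s, 'a) traj = "('s \<times> 'a) list \<times> 's"

text \<open>\<open>mdp_run M pol t\<close> is the joint law of \<open>(S\<^sub>0, A\<^sub>0, \<dots>, S\<^sub>t)\<close>, not stopped at terminal states.\<close>

primrec mdp_run :: "('s, 'a) mdp \<Rightarrow> ('s \<Rightarrow> 'a pmf) \<Rightarrow> nat \<Rightarrow> ('s, 'a) traj pmf" where
  "mdp_run M pol 0 = map_pmf (\<lambda>s. ([], s)) (initial M)"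
| "mdp_run M pol (Suc t) = do {
     (h, s) \<leftarrow> mdp_run M pol t;
     a \<leftarrow> pol s;
     s' \<leftarrow> transition M s a;
     return_pmf (h @ [(s, a)], s')
   }"

definition mdp_trajs :: "('s, 'a) mdp \<Rightarrow> ('s, 'a) traj set" where
  "mdp_trajs M = {(h, s). (\<forall>x\<in>set h. fst x \<notin> terminal M) \<and> s \<in> terminal M}"

definition mdp_traj_prob :: "('s, 'a) mdp \<Rightarrow> ('s \<Rightarrow> 'a pmf) \<Rightarrow> ('s, 'a) traj \<Rightarrow> real" where
  "mdp_traj_prob M pol \<tau> = pmf (mdp_run M pol (length (fst \<tau>))) \<tau>"

definition mdp_return :: "('s, 'a) mdp \<Rightarrow> ('s, 'a) traj \<Rightarrow> real" where
  "mdp_return M \<tau> =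
     (\<Sum>t<length (fst \<tau>). discount M ^ t * (case fst \<tau> ! t of (s, a) \<Rightarrow> reward M s a))"

definition mdp_expected_return :: "('s, 'a) mdp \<Rightarrow> ('s \<Rightarrow> 'a pmf) \<Rightarrow> real" where
  "mdp_expected_return M pol =
     (\<Sum>\<^sub>\<infinity>\<tau>\<in>mdp_trajs M. mdp_return M \<tau> * mdp_traj_prob M pol \<tau>)"


section \<open>Call-and-return execution of options\<close>

text \<open>\<open>next_option F \<pi> w s\<close> is \<open>p(\<cdot> | s, w)\<close>: the option used at \<open>s\<close> if \<open>w\<close> was used one step earlier.\<close>

definition next_option ::
  "('s, 'a, 'w) option_family \<Rightarrow> ('s \<Rightarrow> 'w pmf) \<Rightarrow> 'w \<Rightarrow> 's \<Rightarrow> 'w pmf" where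
  "next_option F \<pi> w s = do {
     stop \<leftarrow> bernoulli_pmf (beta F w s);
     if stop then \<pi> s else return_pmf w
   }"

text \<open>
  \<open>(S\<^sub>0, O\<^sub>0, A\<^sub>0, \<dots>, S\<^sub>T, O\<^sub>T)\<close> is represented by the list of the triples \<open>(S\<^sub>t, O\<^sub>t, A\<^sub>t)\<close>, \<open>t < T\<close>,
  together with \<open>(S\<^sub>T, O\<^sub>T)\<close>.
\<close>

type_synonym ('s, 'a, 'w) option_traj = "('s \<times> 'w \<times> 'a) list \<times> ('s \<times> 'w)"

primrec option_run ::
  "('s, 'a) mdp \<Rightarrow> ('s, 'a, 'w) option_family \<Rightarrow> ('s \<Rightarrow> 'w pmf) \<Rightarrow> nat \<Rightarrow> ('s, 'a, 'w) option_traj pmf"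
where
  "option_run M F \<pi> 0 = do {
     s \<leftarrow> initial M;
     w \<leftarrow> \<pi> s;
     return_pmf ([], (s, w))
   }"
| "option_run M F \<pi> (Suc t) = do {
     (h, (s, w)) \<leftarrow> option_run M F \<pi> t;
     a \<leftarrow> intra F w s;
     s' \<leftarrow> transition M s a;
     w' \<leftarrow> next_option F \<pi> w s';
     return_pmf (h @ [(s, w, a)], (s', w'))
   }"

definition option_trajs :: "('s, 'a) mdp \<Rightarrow> ('s, 'a, 'w) option_traj set" where
  "option_trajs M = {(h, (s, w)). (\<forall>x\<in>set h. fst x \<notin> terminal M) \<and> s \<in> terminal M}"

definition option_traj_prob ::
  "('s, 'a) mdp \<Rightarrow> ('s, 'a, 'w) option_family \<Rightarrow> ('s \<Rightarrow> 'w pmf) \<Rightarrow> ('s, 'a, 'w) option_traj \<Rightarrow> real"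
where
  "option_traj_prob M F \<pi> \<tau> = pmf (option_run M F \<pi> (length (fst \<tau>))) \<tau>"

definition option_return :: "('s, 'a) mdp \<Rightarrow> ('s, 'a, 'w) option_traj \<Rightarrow> real" where
  "option_return M \<tau> =
     (\<Sum>t<length (fst \<tau>). discount M ^ t * (case fst \<tau> ! t of (s, w, a) \<Rightarrow> reward M s a))"

definition option_expected_return ::
  "('s, 'a) mdp \<Rightarrow> ('s, 'a, 'w) option_family \<Rightarrow> ('s \<Rightarrow> 'w pmf) \<Rightarrow> real" where
  "option_expected_return M F \<pi> =
     (\<Sum>\<^sub>\<infinity>\<tau>\<in>option_trajs M. option_return M \<tau> * option_traj_prob M F \<pi> \<tau>)"

text \<open>
  Almost sure termination. The event \<open>T < \<infinity>\<close> is the disjoint union, over all trajectories \<open>\<tau>\<close>,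
  of the events that \<open>\<tau>\<close> is generated.
\<close>

definition terminates_almost_surely ::
  "('s, 'a) mdp \<Rightarrow> ('s, 'a, 'w) option_family \<Rightarrow> ('s \<Rightarrow> 'w pmf) \<Rightarrow> bool" where
  "terminates_almost_surely M F \<pi> \<longleftrightarrow> (option_traj_prob M F \<pi> has_sum 1) (option_trajs M)"


section \<open>The augmented MDPs\<close>

definition option_trans ::
  "('s, 'a) mdp \<Rightarrow> ('s, 'a, 'w) option_family \<Rightarrow> 's \<Rightarrow> 'w \<Rightarrow> 's pmf" where
  "option_trans M F s w = do { a \<leftarrow> intra F w s; transition M s a }"

definition option_reward ::
  "('s, 'a) mdp \<Rightarrow> ('s, 'a, 'w) option_family \<Rightarrow> 's \<Rightarrow> 'w \<Rightarrow> real" where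
  "option_reward M F s w = (\<Sum>\<^sub>\<infinity>a. pmf (intra F w s) a * reward M s a)"

text \<open>In the high-MDP, \<open>None\<close> is the dummy option \<open>#\<close>.\<close>

definition high_mdp ::
  "('s, 'a) mdp \<Rightarrow> ('s, 'a, 'w) option_family \<Rightarrow> ('w option \<times> 's, 'w) mdp" where
  "high_mdp M F =
     \<lparr> initial = map_pmf (\<lambda>s. (None, s)) (initial M),
       transition = (\<lambda>(x, s) w'. map_pmf (\<lambda>s'. (Some w', s')) (option_trans M F s w')),
       reward = (\<lambda>(x, s) w'. option_reward M F s w'),
       discount = discount M,
       terminal = {(x, s). s \<in> terminal M} \<rparr>"

definition high_policy ::
  "('s, 'a, 'w) option_family \<Rightarrow> ('s \<Rightarrow> 'w pmf) \<Rightarrow> 'w option \<times> 's \<Rightarrow> 'w pmf" where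
  "high_policy F \<pi> = (\<lambda>(x, s). case x of None \<Rightarrow> \<pi> s | Some w \<Rightarrow> next_option F \<pi> w s)"

definition low_mdp ::
  "('s, 'a) mdp \<Rightarrow> ('s, 'a, 'w) option_family \<Rightarrow> ('s \<Rightarrow> 'w pmf) \<Rightarrow> ('s \<times> 'w, 'a) mdp" where
  "low_mdp M F \<pi> =
     \<lparr> initial = do { s \<leftarrow> initial M; w \<leftarrow> \<pi> s; return_pmf (s, w) },
       transition = (\<lambda>(s, w) a. do {
         s' \<leftarrow> transition M s a;
         w' \<leftarrow> next_option F \<pi> w s';
         return_pmf (s', w')
       }),
       reward = (\<lambda>(s, w) a. reward M s a),
       discount = discount M,
       terminal = {(s, w). s \<in> terminal M} \<rparr>"

definition low_policy :: "('s, 'a, 'w) option_family \<Rightarrow> 's \<times> 'w \<Rightarrow> 'a pmf" where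
  "low_policy F = (\<lambda>(s, w). intra F w s)"


section \<open>Mass functions of the kernels\<close>

lemma integral_measure_pmf_infsum:
  fixes f :: "'b \<Rightarrow> real"
  assumes "\<And>x. \<bar>f x\<bar> \<le> B"
  shows "measure_pmf.expectation p f = (\<Sum>\<^sub>\<infinity>x. pmf p x * f x)"
proof -
  have "Infinite_Set_Sum.abs_summable_on (\<lambda>x. pmf p x * f x) UNIV"
    unfolding abs_summable_on_def
  proof (rule Bochner_Integration.integrable_bound)
    show "integrable (count_space UNIV) (\<lambda>x. B * pmf p x)"
      using pmf_abs_summable[of p UNIV] by (simp add: abs_summable_on_def)
    show "AE x in count_space UNIV. norm (pmf p x * f x) \<le> norm (B * pmf p x)"
    proof (rule AE_I2)
      fix x
      have "\<bar>f x\<bar> \<le> \<bar>B\<bar>"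
        using assms[of x] by linarith
      then show "norm (pmf p x * f x) \<le> norm (B * pmf p x)"
        by (simp add: abs_mult mult.commute mult_right_mono)
    qed
  qed simp
  then show ?thesis
    by (simp add: pmf_expectation_eq_infsetsum infsetsum_infsum)
qed

lemma pmf_next_option:
  assumes "wf_option_family F"
  shows "pmf (next_option F \<pi> w s) w' =
    (1 - beta F w s) * of_bool (w = w') + beta F w s * pmf (\<pi> s) w'"
  using assms
  by (auto simp: next_option_def wf_option_family_def pmf_bind indicator_def)

lemma pmf_option_trans:
  "pmf (option_trans M F s w) s' = (\<Sum>\<^sub>\<infinity>a. pmf (intra F w s) a * pmf (transition M s a) s')"
  unfolding option_trans_def pmf_bind
  by (rule integral_measure_pmf_infsum[where B = 1]) (simp add: pmf_le_1)

lemma pmf_pair_bind: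
  "pmf (do { x \<leftarrow> p; y \<leftarrow> q x; return_pmf (x, y) }) (a, b) = pmf p a * pmf (q a) b"
proof -
  have "pmf (do { y \<leftarrow> q x; return_pmf (x, y) }) (a, b) = pmf (q a) b * indicator {a} x" for x
  proof (cases "x = a")
    case True
    then show ?thesis
      using pmf_map_inj'[of "Pair a" "q a" b] by (simp add: map_pmf_def inj_on_def)
  next
    case False
    then show ?thesis by (simp add: pmf_bind)
  qed
  then show ?thesis
    by (subst pmf_bind) (simp add: measure_pmf_single)
qed

lemma pmf_map_Pair: "pmf (map_pmf (\<lambda>s. (c, s)) p) (d, s) = of_bool (d = c) * pmf p s"
proof (cases "d = c")
  case True
  then show ?thesis
    using pmf_map_inj'[of "Pair c" p s] by (simp add: inj_on_def)
next
  case False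
  then have "(d, s) \<notin> set_pmf (map_pmf (Pair c) p)" by auto
  then show ?thesis using False by (simp add: set_pmf_iff del: set_map_pmf)
qed

lemma pmf_high_mdp:
  "pmf (initial (high_mdp M F)) (x, s) = pmf (initial M) s * of_bool (x = None)"
  "pmf (transition (high_mdp M F) (x, s) w) (Some w', s') =
     of_bool (w = w') * pmf (option_trans M F s w') s'"
  "pmf (transition (high_mdp M F) (x, s) w) (None, s') = 0"
  by (auto simp: high_mdp_def pmf_map_Pair)

lemma pmf_low_mdp:
  "pmf (initial (low_mdp M F \<pi>)) (s, w) = pmf (initial M) s * pmf (\<pi> s) w"
  "pmf (transition (low_mdp M F \<pi>) (s, w) a) (s', w') =
     pmf (transition M s a) s' * pmf (next_option F \<pi> w s') w'"
  by (simp_all add: low_mdp_def pmf_pair_bind)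

end

theory Submission
  imports Defs
begin

text \<open>
  Rearranging the tuples of a trajectory identifies option execution with the low-MDP. A
  high-MDP trajectory, however, forgets the primitive actions, and its reward is averaged over
  them although the next state depends on the action drawn; so trajectories cannot be matched
  one by one. Instead, freeze an MDP at its first terminal state. Since the probability of not
  having terminated by time \<open>n\<close> tends to 0 and returns are bounded, the expected return is the limit
  of the expected return of the process frozen after \<open>n\<close> steps, i.e. the discounted sum of the
  expected rewards of the single steps. Each of these depends only on the law of the current
  frozen state, and drawing an option from the frozen high-MDP state gives exactly the frozen
  low-MDP state.
\<close>

section \<open>Expectations under mass functions\<close>

lemma integral_bind_pmf:
  fixes f :: "'b \<Rightarrow> real"
  assumes "\<And>x. \<bar>f x\<bar> \<le> B"
  shows "measure_pmf.expectation (bind_pmf p q) f =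
    measure_pmf.expectation p (\<lambda>x. measure_pmf.expectation (q x) f)"
  unfolding measure_pmf_bind
  \<comment> \<open>\<open>B'\<close> bounds the total mass of the kernels \<open>q x\<close>, which
    is 1.\<close>
  by (rule integral_bind[where K = "count_space UNIV" and B = B and B' = 1])
     (use assms measurable_measure_pmf[of q] in
       \<open>auto simp: measure_pmf.emeasure_space_1[simplified]
             intro!: measure_pmf.finite_measure_axioms\<close>)

lemma integrable_measure_pmf_bounded:
  fixes f :: "'b \<Rightarrow> real"
  assumes "\<And>x. \<bar>f x\<bar> \<le> B"
  shows "integrable (measure_pmf p) f"
  by (rule measure_pmf.integrable_const_bound[where B = B]) (use assms in auto)

lemma abs_expectation_pmf_le:
  fixes f :: "'b \<Rightarrow> real"
  assumes "\<And>x. \<bar>f x\<bar> \<le> B"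
  shows "\<bar>measure_pmf.expectation p f\<bar> \<le> B"
proof -
  have f: "integrable (measure_pmf p) f"
    by (rule integrable_measure_pmf_bounded[OF assms])
  have "f x \<le> B" "- B \<le> f x" for x
    using assms[of x] by auto
  then have "measure_pmf.expectation p f \<le> B" "- B \<le> measure_pmf.expectation p f"
    using f by (auto intro!: measure_pmf.integral_le_const measure_pmf.integral_ge_const)
  then show ?thesis
    by simp
qed

lemma has_sum_diff_real:
  fixes f g :: "'b \<Rightarrow> real"
  assumes "(f has_sum a) A" "(g has_sum b) A"
  shows "((\<lambda>x. f x - g x) has_sum (a - b)) A"
  using has_sum_add[OF assms(1) has_sum_cmult_right[OF assms(2), of "- 1"]] by simp

text \<open>Turns an expectation into an unconditional sum, so that it can be compared termwise with
  a sum over trajectories.\<close>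

lemma has_sum_pmf_mult:
  fixes f :: "'b \<Rightarrow> real"
  assumes "\<And>x. \<bar>f x\<bar> \<le> B"
  shows "((\<lambda>x. pmf p x * f x) has_sum measure_pmf.expectation p f) UNIV"
proof -
  have "Infinite_Set_Sum.abs_summable_on (\<lambda>x. B * pmf p x) UNIV"
    using pmf_abs_summable[of p UNIV] by (rule abs_summable_on_cmult_right)
  then have "(\<lambda>x. B * pmf p x) summable_on UNIV"
    using abs_summable_equivalent abs_summable_summable by blast
  then have "(\<lambda>x. norm (pmf p x * f x)) summable_on UNIV"
    by (rule Infinite_Sum.abs_summable_on_comparison_test')
       (use assms in \<open>auto simp: abs_mult mult.commute[of B] intro!: mult_left_mono\<close>)
  then show ?thesis
    unfolding integral_measure_pmf_infsum[OF assms]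
    by (rule has_sum_infsum[OF abs_summable_summable])
qed

section \<open>The run frozen at its first terminal state\<close>

text \<open>Trajectories of different lengths get their probabilities from different laws
  \<open>mdp_run M pol t\<close>. Freezing collects all those completed by time \<open>t\<close> in
  one law.\<close>

primrec stopped_run :: "('s, 'a) mdp \<Rightarrow> ('s \<Rightarrow> 'a pmf) \<Rightarrow> nat \<Rightarrow> ('s, 'a) traj pmf" where
  "stopped_run M pol 0 = map_pmf (\<lambda>s. ([], s)) (initial M)"
| "stopped_run M pol (Suc t) = do {
     (h, s) \<leftarrow> stopped_run M pol t;
     if s \<in> terminal M then return_pmf (h, s)
     else do {
       a \<leftarrow> pol s;
       s' \<leftarrow> transition M s a;
       return_pmf (h @ [(s, a)], s')
     }
   }"

definition stopped_state :: "('s, 'a) mdp \<Rightarrow> ('s \<Rightarrow> 'a pmf) \<Rightarrow> nat \<Rightarrow> 's pmf" where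
  "stopped_state M pol t = map_pmf snd (stopped_run M pol t)"

lemma stopped_state_0: "stopped_state M pol 0 = initial M"
  by (simp add: stopped_state_def pmf.map_comp o_def)

lemma stopped_state_Suc:
  "stopped_state M pol (Suc t) = do {
     s \<leftarrow> stopped_state M pol t;
     if s \<in> terminal M then return_pmf s else do { a \<leftarrow> pol s; transition M s a }
   }"
  unfolding stopped_state_def
  by (auto simp: map_bind_pmf bind_map_pmf bind_return_pmf' map_pmf_def[symmetric]
        pmf.map_comp o_def split_beta intro!: bind_pmf_cong)

lemma stopped_run_support:
  assumes "(h, s) \<in> set_pmf (stopped_run M pol t)"
  shows "(\<forall>x\<in>set h. fst x \<notin> terminal M) \<and> length h \<le> t \<and> (s \<notin> terminal M \<longrightarrow> length h = t)"
  using assms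
proof (induction t arbitrary: h s)
  case (Suc t)
  then show ?case
    by (fastforce split: if_splits)
qed auto

text \<open>The extended history determines its predecessor and the last action, so only the
  predecessor \<open>(g, u)\<close> contributes.\<close>

lemma pmf_traj_step:
  "pmf (do { a \<leftarrow> pol s; s' \<leftarrow> transition M s a; return_pmf (h @ [(s, a)], s') })
     (g @ [(u, b)], v) =
   indicator {(g, u)} (h, s) * (pmf (pol u) b * pmf (transition M u b) v)"
proof (cases "h = g \<and> s = u")
  case True
  have "do { a \<leftarrow> pol s; s' \<leftarrow> transition M s a; return_pmf (h @ [(s, a)], s') } =
    map_pmf (\<lambda>(a, s'). (h @ [(s, a)], s'))
      (do { a \<leftarrow> pol s; s' \<leftarrow> transition M s a; return_pmf (a, s') })"
    by (simp add: map_bind_pmf)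
  moreover have "inj (\<lambda>(a, s'). (h @ [(s, a)], s'))"
    by (auto simp: inj_on_def)
  ultimately show ?thesis
    using True pmf_map_inj'[of "\<lambda>(a, s'). (h @ [(s, a)], s')"
        "do { a \<leftarrow> pol s; s' \<leftarrow> transition M s a; return_pmf (a, s') }" "(b, v)"]
    by (simp add: pmf_pair_bind)
next
  case False
  then have "(g @ [(u, b)], v) \<notin>
      set_pmf (do { a \<leftarrow> pol s; s' \<leftarrow> transition M s a; return_pmf (h @ [(s, a)], s') })"
    by auto
  then show ?thesis
    using False by (auto simp: set_pmf_iff simp del: set_bind_pmf)
qed

lemma pmf_mdp_run_snoc:
  "pmf (mdp_run M pol (Suc t)) (g @ [(u, b)], v) =
   pmf (mdp_run M pol t) (g, u) * (pmf (pol u) b * pmf (transition M u b) v)"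
  by (simp add: pmf_bind[of "mdp_run M pol t"] split_beta pmf_traj_step measure_pmf_single)

text \<open>Along \<open>h\<close> freezing never acts, so both masses obey the same one-step
  recursion; histories grow at the end, hence the reverse induction.\<close>

lemma pmf_stopped_run_eq_mdp_run:
  assumes "\<forall>x\<in>set h. fst x \<notin> terminal M"
  shows "pmf (stopped_run M pol (length h)) (h, s) = pmf (mdp_run M pol (length h)) (h, s)"
  using assms
proof (induction h arbitrary: s rule: rev_induct)
  case (snoc x g)
  obtain u b where x: "x = (u, b)"
    by fastforce
  let ?c = "pmf (pol u) b * pmf (transition M u b) s"
  have u: "u \<notin> terminal M"
    using snoc.prems by (simp add: x)
  have "pmf (if v \<in> terminal M then return_pmf (k, v) else do {
          a \<leftarrow> pol v; s' \<leftarrow> transition M v a; return_pmf (k @ [(v, a)], s') }) (g @ [(u, b)], s) =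
        indicator {(g, u)} (k, v) * ?c"
    if "(k, v) \<in> set_pmf (stopped_run M pol (length g))" for k v
  proof (cases "v \<in> terminal M")
    case True
    \<comment> \<open>At time \<open>length g\<close> the history is too short for the extended
      trajectory, and \<open>u\<close> is not terminal whereas \<open>v\<close> is.\<close>
    then have "(k, v) \<noteq> (g @ [(u, b)], s)" "(k, v) \<noteq> (g, u)"
      using stopped_run_support[OF that] u by auto
    then show ?thesis
      using True by (simp add: indicator_def)
  qed (simp add: pmf_traj_step)
  then have "pmf (stopped_run M pol (Suc (length g))) (g @ [(u, b)], s) =
    measure_pmf.expectation (stopped_run M pol (length g)) (\<lambda>y. indicator {(g, u)} y * ?c)"
    unfolding stopped_run.simps
    by (subst pmf_bind, intro integral_cong_AE) (auto simp: AE_measure_pmf_iff)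
  also have "\<dots> = pmf (stopped_run M pol (length g)) (g, u) * ?c"
    by (simp add: measure_pmf_single)
  also have "\<dots> = pmf (mdp_run M pol (length g)) (g, u) * ?c"
    using snoc by simp
  finally show ?case
    using pmf_mdp_run_snoc[of M pol "length g" g u b s] by (simp add: x)
qed simp

text \<open>A run still moving at time \<open>t\<close> has a history of length \<open>t\<close>, so
  its next outcome is too long to be \<open>\<tau>\<close>. A completed trajectory thus neither
  gains nor loses mass.\<close>

lemma pmf_stopped_run_Suc:
  assumes "snd \<tau> \<in> terminal M" "length (fst \<tau>) \<le> t"
  shows "pmf (stopped_run M pol (Suc t)) \<tau> = pmf (stopped_run M pol t) \<tau>"
proof -
  have "pmf (if s \<in> terminal M then return_pmf (h, s) else do {
          a \<leftarrow> pol s; s' \<leftarrow> transition M s a; return_pmf (h @ [(s, a)], s') }) \<tau> =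
        indicator {\<tau>} (h, s)"
    if "(h, s) \<in> set_pmf (stopped_run M pol t)" for h s
  proof (cases "s \<in> terminal M")
    case False
    then have "length h = t"
      using stopped_run_support[OF that] by simp
    then have "\<tau> \<notin> set_pmf (do {
        a \<leftarrow> pol s; s' \<leftarrow> transition M s a; return_pmf (h @ [(s, a)], s') })"
      using assms(2) by auto
    moreover have "\<tau> \<noteq> (h, s)"
      using False assms(1) by auto
    ultimately show ?thesis
      using False by (simp add: set_pmf_iff indicator_def del: set_bind_pmf)
  qed (auto split: split_indicator)
  then have "pmf (stopped_run M pol (Suc t)) \<tau> =
    measure_pmf.expectation (stopped_run M pol t) (indicator {\<tau>})"
    unfolding stopped_run.simps
    by (subst pmf_bind, intro integral_cong_AE) (auto simp: AE_measure_pmf_iff)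
  then show ?thesis
    by (simp add: measure_pmf_single)
qed

lemma pmf_stopped_run_eq_traj_prob:
  assumes "\<tau> \<in> mdp_trajs M" "length (fst \<tau>) \<le> t"
  shows "pmf (stopped_run M pol t) \<tau> = mdp_traj_prob M pol \<tau>"
  using assms(2)
proof (induction rule: dec_induct)
  case base
  then show ?case
    using assms(1) pmf_stopped_run_eq_mdp_run[of "fst \<tau>" M pol "snd \<tau>"]
    by (auto simp: mdp_trajs_def mdp_traj_prob_def)
next
  case (step t)
  then show ?case
    using assms(1) pmf_stopped_run_Suc[of \<tau> M t pol] by (auto simp: mdp_trajs_def)
qed

lemma stopped_run_terminal_iff:
  assumes "\<tau> \<in> set_pmf (stopped_run M pol t)"
  shows "snd \<tau> \<in> terminal M \<longleftrightarrow> \<tau> \<in> mdp_trajs M \<and> length (fst \<tau>) \<le> t"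
  using stopped_run_support[of "fst \<tau>" "snd \<tau>" M pol t] assms
  by (cases \<tau>) (auto simp: mdp_trajs_def)

section \<open>Trajectory probabilities and termination\<close>

lemma mdp_traj_prob_nonneg: "0 \<le> mdp_traj_prob M pol \<tau>"
  by (simp add: mdp_traj_prob_def)

text \<open>By time \<open>t\<close> the trajectories in \<open>X\<close> are distinct outcomes of a
  single law, so their probabilities add up to that of an event.\<close>

lemma sum_mdp_traj_prob_le:
  assumes "finite X" "X \<subseteq> mdp_trajs M" "\<And>\<tau>. \<tau> \<in> X \<Longrightarrow> length (fst \<tau>) \<le> t"
  shows "(\<Sum>\<tau>\<in>X. mdp_traj_prob M pol \<tau>) \<le> measure_pmf.prob (stopped_state M pol t) (terminal M)"
proof -
  have "(\<Sum>\<tau>\<in>X. mdp_traj_prob M pol \<tau>) = (\<Sum>\<tau>\<in>X. pmf (stopped_run M pol t) \<tau>)"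
    using assms by (intro sum.cong) (auto simp: pmf_stopped_run_eq_traj_prob)
  also have "\<dots> = measure_pmf.prob (stopped_run M pol t) X"
    using assms(1) by (simp add: measure_measure_pmf_finite)
  also have "\<dots> \<le> measure_pmf.prob (stopped_run M pol t) (snd -` terminal M)"
    using assms(2) by (intro measure_pmf.finite_measure_mono) (auto simp: mdp_trajs_def)
  finally show ?thesis
    by (simp add: stopped_state_def)
qed

lemma sum_mdp_traj_prob_le_1:
  assumes "finite X" "X \<subseteq> mdp_trajs M"
  shows "(\<Sum>\<tau>\<in>X. mdp_traj_prob M pol \<tau>) \<le> 1"
proof -
  \<comment> \<open>The sum of the lengths is a common bound that avoids a maximum over a possibly
    empty set.\<close>
  have "length (fst \<tau>) \<le> (\<Sum>\<tau>\<in>X. length (fst \<tau>))" if "\<tau> \<in> X" for \<tau>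
    using that assms(1) by (intro member_le_sum) auto
  then show ?thesis
    using order_trans[OF sum_mdp_traj_prob_le[OF assms] measure_pmf.prob_le_1] by blast
qed

lemma mdp_traj_prob_summable: "mdp_traj_prob M pol summable_on mdp_trajs M"
  using sum_mdp_traj_prob_le_1
  by (intro nonneg_bdd_above_summable_on mdp_traj_prob_nonneg bdd_aboveI2[where M = 1]) auto

lemma nonterminal_prob_tendsto_0:
  assumes "(mdp_traj_prob M pol has_sum 1) (mdp_trajs M)"
  shows "(\<lambda>t. measure_pmf.prob (stopped_state M pol t) (- terminal M)) \<longlonglongrightarrow> 0"
proof (rule LIMSEQ_I)
  fix e :: real
  assume "0 < e"
  \<comment> \<open>The approximation is non-strict; \<open>e / 2\<close> leaves room for the strict
    bound by \<open>e\<close>.\<close>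
  then obtain X where X: "finite X" "X \<subseteq> mdp_trajs M"
      "dist (sum (mdp_traj_prob M pol) X) 1 \<le> e / 2"
    using has_sum_finite_approximation[OF assms, of "e / 2"] by auto
  have "norm (measure_pmf.prob (stopped_state M pol t) (- terminal M) - 0) < e"
    if "(\<Sum>\<tau>\<in>X. length (fst \<tau>)) \<le> t" for t
  proof -
    have "length (fst \<tau>) \<le> t" if "\<tau> \<in> X" for \<tau>
      using member_le_sum[OF that, of "\<lambda>\<tau>. length (fst \<tau>)"] X(1)
        \<open>(\<Sum>\<tau>\<in>X. length (fst \<tau>)) \<le> t\<close> by simp
    then have "sum (mdp_traj_prob M pol) X \<le> measure_pmf.prob (stopped_state M pol t) (terminal M)"
      by (rule sum_mdp_traj_prob_le[OF X(1,2)])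
    then have "1 - e / 2 \<le> measure_pmf.prob (stopped_state M pol t) (terminal M)"
      using X(3) unfolding dist_real_def by linarith
    then show ?thesis
      using \<open>0 < e\<close> measure_pmf.prob_compl[of "terminal M" "stopped_state M pol t"]
      by (simp add: Compl_eq_Diff_UNIV)
  qed
  then show "\<exists>n. \<forall>t\<ge>n. norm (measure_pmf.prob (stopped_state M pol t) (- terminal M) - 0) < e"
    by blast
qed

text \<open>
  Both the mass of the run that is not yet terminal at time \<open>t\<close> and the mass of the trajectories
  longer than \<open>t\<close> are at most the nonterminal probability, hence the factor 2.
\<close>

lemma stopped_run_expectation_error:
  assumes f: "\<And>\<tau>. \<bar>f \<tau>\<bar> \<le> C"
  shows "\<bar>measure_pmf.expectation (stopped_run M pol t) f -
      (\<Sum>\<^sub>\<infinity>\<tau>\<in>mdp_trajs M. f \<tau> * mdp_traj_prob M pol \<tau>)\<bar>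
    \<le> C * (2 * measure_pmf.prob (stopped_state M pol t) (- terminal M))"
proof -
  define q where "q = stopped_run M pol t"
  \<comment> \<open>Extension by zero lets trajectory probabilities be compared with
    \<open>pmf q\<close> on all histories.\<close>
  define p where "p = (\<lambda>\<tau>. if \<tau> \<in> mdp_trajs M then mdp_traj_prob M pol \<tau> else 0)"
  define A where "A = {\<tau> \<in> mdp_trajs M. length (fst \<tau>) \<le> t}"
  define J where "J = (\<Sum>\<^sub>\<infinity>\<tau>\<in>mdp_trajs M. f \<tau> * mdp_traj_prob M pol \<tau>)"
  define P where "P = infsum (mdp_traj_prob M pol) (mdp_trajs M)"
  define u where "u = measure_pmf.prob (stopped_state M pol t) (- terminal M)"
  have "0 \<le> C"
    using f by (meson abs_ge_zero order_trans)
  have P: "(mdp_traj_prob M pol has_sum P) (mdp_trajs M)"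
    unfolding P_def by (rule has_sum_infsum[OF mdp_traj_prob_summable])
  then have "P \<le> 1"
    by (rule has_sum_le_finite_sums) (rule sum_mdp_traj_prob_le_1)
  have p: "(p has_sum P) UNIV"
    using P by (subst has_sum_cong_neutral[where T = "mdp_trajs M" and g = "mdp_traj_prob M pol"])
      (auto simp: p_def)
  have "(\<lambda>\<tau>. norm (f \<tau> * mdp_traj_prob M pol \<tau>)) summable_on mdp_trajs M"
    by (rule Infinite_Sum.abs_summable_on_comparison_test'
          [OF summable_on_cmult_right[OF mdp_traj_prob_summable, of C]])
       (use f in \<open>auto simp: abs_mult mdp_traj_prob_nonneg intro!: mult_right_mono\<close>)
  then have "((\<lambda>\<tau>. f \<tau> * mdp_traj_prob M pol \<tau>) has_sum J) (mdp_trajs M)"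
    unfolding J_def by (rule has_sum_infsum[OF abs_summable_summable])
  then have J: "((\<lambda>\<tau>. p \<tau> * f \<tau>) has_sum J) UNIV"
    by (subst has_sum_cong_neutral[where T = "mdp_trajs M" and
          g = "\<lambda>\<tau>. f \<tau> * mdp_traj_prob M pol \<tau>"])
       (auto simp: p_def)
  have q: "(pmf q has_sum 1) UNIV"
    using has_sum_pmf_mult[of "\<lambda>_. 1" 1 q] by simp
  have "measure_pmf.prob q A = measure_pmf.prob q (snd -` terminal M)"
    using stopped_run_terminal_iff[of _ M pol t]
    by (intro measure_pmf.finite_measure_eq_AE) (auto simp: AE_measure_pmf_iff A_def q_def)
  also have "\<dots> = 1 - u"
    using measure_pmf.prob_compl[of "terminal M" "stopped_state M pol t"]
    by (simp add: u_def Compl_eq_Diff_UNIV stopped_state_def q_def)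
  finally have qA: "((\<lambda>\<tau>. pmf q \<tau> * indicator A \<tau>) has_sum (1 - u)) UNIV"
    using has_sum_pmf_mult[of "indicator A" 1 q] by (simp add: indicator_def)
  have pA: "p \<tau> = pmf q \<tau>" if "\<tau> \<in> A" for \<tau>
    using that pmf_stopped_run_eq_traj_prob[of \<tau> M t pol] by (auto simp: A_def p_def q_def)
  \<comment> \<open>On \<open>A\<close> the two masses agree and both sides vanish; off
    \<open>A\<close> the difference of the masses is bounded by their sum.\<close>
  have bound: "norm (pmf q \<tau> * f \<tau> - p \<tau> * f \<tau>) \<le>
      C * (pmf q \<tau> + p \<tau> - 2 * (pmf q \<tau> * indicator A \<tau>))" for \<tau>
  proof (cases "\<tau> \<in> A")
    case False
    have "\<bar>pmf q \<tau> * f \<tau> - p \<tau> * f \<tau>\<bar> = \<bar>f \<tau>\<bar> * \<bar>pmf q \<tau> - p \<tau>\<bar>"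
      by (simp add: abs_mult[symmetric] algebra_simps)
    also have "\<dots> \<le> C * (pmf q \<tau> + p \<tau>)"
    proof (intro mult_mono f \<open>0 \<le> C\<close> abs_ge_zero)
      have "0 \<le> p \<tau>"
        by (simp add: p_def mdp_traj_prob_nonneg)
      then show "\<bar>pmf q \<tau> - p \<tau>\<bar> \<le> pmf q \<tau> + p \<tau>"
        using pmf_nonneg[of q \<tau>] by linarith
    qed
    finally show ?thesis
      using False by simp
  qed (simp add: pA)
  \<comment> \<open>Summing the pointwise bound gives \<open>C * (P - 1 + 2 * u)\<close>, and
    \<open>P \<le> 1\<close> removes the first two terms.\<close>
  have "norm (measure_pmf.expectation q f - J) \<le> C * (1 + P - 2 * (1 - u))"
    by (rule norm_infsum_le[OF has_sum_diff_real[OF has_sum_pmf_mult[OF f] J]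
        has_sum_cmult_right[OF has_sum_diff_real[OF has_sum_add[OF q p] has_sum_cmult_right[OF qA]]]])
       (rule bound)
  also have "\<dots> \<le> C * (2 * u)"
    using \<open>0 \<le> C\<close> \<open>P \<le> 1\<close> by (intro mult_left_mono) auto
  finally show ?thesis
    by (simp add: q_def J_def u_def)
qed

section \<open>Returns as sums of stage rewards\<close>

lemma mdp_return_snoc:
  "mdp_return M (h @ [(s, a)], s') = mdp_return M (h, s) + discount M ^ length h * reward M s a"
  by (simp add: mdp_return_def nth_append)

text \<open>The geometric series bounds returns uniformly in the length, so the error estimate
  applies with one constant at all times.\<close>

lemma mdp_return_bounded:
  assumes "wf_mdp M" and B: "\<And>s a. \<bar>reward M s a\<bar> \<le> B"
  shows "\<bar>mdp_return M \<tau>\<bar> \<le> B / (1 - discount M)"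
proof -
  let ?g = "discount M"
  have g: "0 \<le> ?g" "?g < 1"
    using assms(1) by (auto simp: wf_mdp_def)
  have "0 \<le> B"
    using B by (meson abs_ge_zero order_trans)
  have "\<bar>mdp_return M \<tau>\<bar> \<le> (\<Sum>t<length (fst \<tau>). ?g ^ t * B)"
    unfolding mdp_return_def
    by (rule order_trans[OF sum_abs])
       (use g B in \<open>auto simp: abs_mult split_beta intro!: sum_mono mult_left_mono\<close>)
  also have "\<dots> = B * (\<Sum>t<length (fst \<tau>). ?g ^ t)"
    by (simp add: sum_distrib_left mult.commute)
  also have "\<dots> \<le> B * (1 / (1 - ?g))"
  proof (rule mult_left_mono[OF _ \<open>0 \<le> B\<close>])
    have "(\<Sum>t<length (fst \<tau>). ?g ^ t) \<le> (\<Sum>t. ?g ^ t)"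
      using g by (intro sum_le_suminf summable_geometric) auto
    then show "(\<Sum>t<length (fst \<tau>). ?g ^ t) \<le> 1 / (1 - ?g)"
      using g by (simp add: suminf_geometric)
  qed
  finally show ?thesis
    by simp
qed

text \<open>The indicator stops a frozen state from collecting its reward again at every later
  time.\<close>

definition expected_stage_reward :: "('s, 'a) mdp \<Rightarrow> ('s \<Rightarrow> 'a pmf) \<Rightarrow> nat \<Rightarrow> real" where
  "expected_stage_reward M pol t = measure_pmf.expectation (stopped_state M pol t)
     (\<lambda>s. indicator (- terminal M) s * measure_pmf.expectation (pol s) (reward M s))"

text \<open>In step \<open>n\<close> a frozen run gains nothing. A moving run has a history of
  length \<open>n\<close>, so the discount exponent of its new reward is the clock time, independent
  of the history.\<close>

lemma expectation_stopped_return: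
  assumes "wf_mdp M"
  shows "measure_pmf.expectation (stopped_run M pol n) (mdp_return M) =
    (\<Sum>t<n. discount M ^ t * expected_stage_reward M pol t)"
proof (induction n)
  case 0
  then show ?case
    by (simp add: mdp_return_def)
next
  case (Suc n)
  obtain B where B: "\<bar>reward M s a\<bar> \<le> B" for s a
    using assms by (auto simp: wf_mdp_def)
  note ret = mdp_return_bounded[OF assms B]
  define R where "R s = indicator (- terminal M) s * measure_pmf.expectation (pol s) (reward M s)" for s
  have R: "\<bar>R s\<bar> \<le> B" for s
    using abs_expectation_pmf_le[of "reward M s" B "pol s"] B order_trans[OF abs_ge_zero B]
    by (auto simp: R_def indicator_def)
  have step: "measure_pmf.expectation (if s \<in> terminal M then return_pmf (h, s) else do {
          a \<leftarrow> pol s; s' \<leftarrow> transition M s a; return_pmf (h @ [(s, a)], s') }) (mdp_return M) =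
        mdp_return M (h, s) + discount M ^ n * R s"
    if "(h, s) \<in> set_pmf (stopped_run M pol n)" for h s
  proof (cases "s \<in> terminal M")
    case False
    then have "length h = n"
      using stopped_run_support[OF that] by simp
    then show ?thesis
      using False integrable_measure_pmf_bounded[OF B, of "pol s"]
      by (simp add: integral_bind_pmf[OF ret] mdp_return_snoc R_def)
  qed (simp add: R_def)
  have "measure_pmf.expectation (stopped_run M pol (Suc n)) (mdp_return M) =
    measure_pmf.expectation (stopped_run M pol n)
      (\<lambda>\<tau>. mdp_return M \<tau> + discount M ^ n * R (snd \<tau>))"
    unfolding stopped_run.simps
    by (subst integral_bind_pmf[OF ret], intro integral_cong_AE)
       (use step in \<open>auto simp: AE_measure_pmf_iff\<close>)
  also have "\<dots> = measure_pmf.expectation (stopped_run M pol n) (mdp_return M) +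
      discount M ^ n * measure_pmf.expectation (stopped_run M pol n) (\<lambda>\<tau>. R (snd \<tau>))"
    by (subst Bochner_Integration.integral_add)
       (auto intro: integrable_measure_pmf_bounded[OF ret]
          integrable_measure_pmf_bounded[of "\<lambda>\<tau>. R (snd \<tau>)", OF R])
  also have "measure_pmf.expectation (stopped_run M pol n) (\<lambda>\<tau>. R (snd \<tau>)) =
      expected_stage_reward M pol n"
    by (simp add: expected_stage_reward_def stopped_state_def R_def)
  finally show ?case
    by (simp add: Suc.IH)
qed

lemma expected_stage_reward_sums:
  assumes "wf_mdp M"
    and "(\<lambda>t. measure_pmf.prob (stopped_state M pol t) (- terminal M)) \<longlonglongrightarrow> 0"
  shows "(\<lambda>t. discount M ^ t * expected_stage_reward M pol t) sums mdp_expected_return M pol"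
proof -
  obtain B where B: "\<bar>reward M s a\<bar> \<le> B" for s a
    using assms(1) by (auto simp: wf_mdp_def)
  note ret = mdp_return_bounded[OF assms(1) B]
  have "(\<lambda>n. measure_pmf.expectation (stopped_run M pol n) (mdp_return M) -
      mdp_expected_return M pol) \<longlonglongrightarrow> 0"
  proof (rule Lim_null_comparison)
    show "\<forall>\<^sub>F n in sequentially. norm (measure_pmf.expectation (stopped_run M pol n) (mdp_return M) -
        mdp_expected_return M pol) \<le> B / (1 - discount M) *
          (2 * measure_pmf.prob (stopped_state M pol n) (- terminal M))"
      unfolding mdp_expected_return_def real_norm_def
      by (intro always_eventually allI stopped_run_expectation_error ret)
    show "(\<lambda>n. B / (1 - discount M) *
        (2 * measure_pmf.prob (stopped_state M pol n) (- terminal M))) \<longlonglongrightarrow> 0"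
      using tendsto_mult_right_zero[OF tendsto_mult_right_zero[OF assms(2)]] by blast
  qed
  then show ?thesis
    by (simp add: LIM_zero_iff expectation_stopped_return[OF assms(1)] sums_def)
qed

section \<open>Option execution as the low-MDP\<close>

text \<open>Only the listed triples are regrouped: the final pair is already a low-MDP
  state.\<close>

definition low_traj :: "('s, 'a, 'w) option_traj \<Rightarrow> ('s \<times> 'w, 'a) traj" where
  "low_traj = apfst (map (\<lambda>(s, w, a). ((s, w), a)))"

lemma inj_low_traj: "inj low_traj"
  unfolding low_traj_def
  by (auto simp: inj_on_def dest!: map_inj_on)

lemma bij_low_traj: "bij_betw low_traj (option_trajs M) (mdp_trajs (low_mdp M F \<pi>))"
  by (rule bij_betw_byWitness[where f' = "apfst (map (\<lambda>((s, w), a). (s, w, a)))"])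
     (fastforce simp: low_traj_def option_trajs_def mdp_trajs_def low_mdp_def o_def split_beta)+

text \<open>Both processes draw action, state and option in the same order; the low-MDP merely
  brackets the last two draws into its transition.\<close>

lemma map_low_traj_option_run:
  "map_pmf low_traj (option_run M F \<pi> t) = mdp_run (low_mdp M F \<pi>) (low_policy F) t"
proof (induction t)
  case 0
  then show ?case
    by (simp add: low_mdp_def map_bind_pmf low_traj_def)
next
  case (Suc t)
  show ?case
    unfolding mdp_run.simps Suc[symmetric]
    by (auto simp: map_bind_pmf bind_map_pmf low_policy_def low_mdp_def low_traj_def
        bind_assoc_pmf bind_return_pmf split_beta intro!: bind_pmf_cong)
qed

lemma low_traj_prob:
  "mdp_traj_prob (low_mdp M F \<pi>) (low_policy F) (low_traj \<tau>) = option_traj_prob M F \<pi> \<tau>"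
proof -
  have "length (fst (low_traj \<tau>)) = length (fst \<tau>)"
    by (simp add: low_traj_def)
  then show ?thesis
    by (simp add: mdp_traj_prob_def option_traj_prob_def map_low_traj_option_run[symmetric]
        pmf_map_inj'[OF inj_low_traj])
qed

lemma low_traj_return: "mdp_return (low_mdp M F \<pi>) (low_traj \<tau>) = option_return M \<tau>"
  by (auto simp: mdp_return_def option_return_def low_traj_def low_mdp_def split_beta
      intro!: sum.cong)

text \<open>The bijection preserves both the return and the probability, so the sums differ only by
  reindexing.\<close>

lemma low_expected_return:
  "mdp_expected_return (low_mdp M F \<pi>) (low_policy F) = option_expected_return M F \<pi>"
  unfolding mdp_expected_return_def option_expected_return_def
  by (subst infsum_reindex_bij_betw[OF bij_low_traj, symmetric])
     (simp add: low_traj_return low_traj_prob)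

section \<open>Comparing the low-MDP with the high-MDP\<close>

text \<open>The option that the low-MDP stores in its state is the action about to be chosen in the
  high-MDP. A high step records it as \<open>Some w\<close>, from which the next option is drawn by
  \<open>next_option\<close>; a frozen high state keeps its previous option, so the law of the
  pending option does not change either.\<close>

lemma low_stopped_state:
  "stopped_state (low_mdp M F \<pi>) (low_policy F) t = do {
     (x, s) \<leftarrow> stopped_state (high_mdp M F) (high_policy F \<pi>) t;
     w \<leftarrow> high_policy F \<pi> (x, s);
     return_pmf (s, w)
   }"
proof (induction t)
  case 0
  then show ?case
    by (simp add: stopped_state_0 low_mdp_def high_mdp_def high_policy_def bind_map_pmf)
next
  case (Suc t)
  show ?case
    unfolding stopped_state_Suc Suc
    by (auto simp: low_mdp_def low_policy_def high_mdp_def high_policy_def option_trans_def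
        bind_assoc_pmf bind_return_pmf bind_map_pmf split_beta
        split: option.split intro!: bind_pmf_cong)
qed

text \<open>Transfers termination to the high-MDP: being terminal depends only on the original
  state, whose frozen law is common to both.\<close>

lemma low_terminal_prob:
  "measure_pmf.prob (stopped_state (low_mdp M F \<pi>) (low_policy F) t) (- terminal (low_mdp M F \<pi>)) =
   measure_pmf.prob (stopped_state (high_mdp M F) (high_policy F \<pi>) t) (- terminal (high_mdp M F))"
proof -
  let ?L = "stopped_state (low_mdp M F \<pi>) (low_policy F) t"
  let ?H = "stopped_state (high_mdp M F) (high_policy F \<pi>) t"
  have "map_pmf fst ?L = map_pmf snd ?H"
    unfolding low_stopped_state
    by (simp add: map_bind_pmf split_beta map_pmf_def[of snd])
  then have "measure_pmf.prob (map_pmf fst ?L) (- terminal M) =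
      measure_pmf.prob (map_pmf snd ?H) (- terminal M)"
    by simp
  moreover have "fst -` (- terminal M) = - terminal (low_mdp M F \<pi>)"
    "snd -` (- terminal M) = - terminal (high_mdp M F)"
    by (auto simp: low_mdp_def high_mdp_def)
  ultimately show ?thesis
    by simp
qed

lemma option_reward_expectation:
  assumes "wf_mdp M"
  shows "option_reward M F s w = measure_pmf.expectation (intra F w s) (reward M s)"
proof -
  obtain B where "\<bar>reward M s a\<bar> \<le> B" for a
    using assms by (auto simp: wf_mdp_def)
  then show ?thesis
    unfolding option_reward_def by (rule integral_measure_pmf_infsum[symmetric])
qed

lemma option_reward_bounded:
  assumes "wf_mdp M"
  obtains B where "\<And>s w. \<bar>option_reward M F s w\<bar> \<le> B"
proof -
  obtain B where B: "\<bar>reward M s a\<bar> \<le> B" for s a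
    using assms by (auto simp: wf_mdp_def)
  show thesis
    by (rule that[of B]) (simp add: option_reward_expectation[OF assms] abs_expectation_pmf_le[OF B])
qed

lemma wf_high_mdp:
  assumes "wf_mdp M"
  shows "wf_mdp (high_mdp M F)"
proof -
  obtain B where "\<And>s w. \<bar>option_reward M F s w\<bar> \<le> B"
    using option_reward_bounded[OF assms] by blast
  then show ?thesis
    using assms by (auto simp: wf_mdp_def high_mdp_def)
qed

lemma wf_low_mdp:
  assumes "wf_mdp M"
  shows "wf_mdp (low_mdp M F \<pi>)"
  using assms by (auto simp: wf_mdp_def low_mdp_def)

lemma low_expected_stage_reward:
  assumes "wf_mdp M"
  shows "expected_stage_reward (low_mdp M F \<pi>) (low_policy F) t =
    expected_stage_reward (high_mdp M F) (high_policy F \<pi>) t"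
proof -
  obtain B where B: "\<And>s w. \<bar>option_reward M F s w\<bar> \<le> B"
    using option_reward_bounded[OF assms] by blast
  define f where "f = (\<lambda>(s, w). indicator (- terminal M) s * option_reward M F s w)"
  have "\<bar>f y\<bar> \<le> B" for y
    using B[of "fst y" "snd y"] by (auto simp: f_def indicator_def split_beta)
  note bind = integral_bind_pmf[of f, OF this]
  have "expected_stage_reward (low_mdp M F \<pi>) (low_policy F) t =
      measure_pmf.expectation (stopped_state (low_mdp M F \<pi>) (low_policy F) t) f"
    unfolding expected_stage_reward_def
    by (intro Bochner_Integration.integral_cong)
       (auto simp: f_def low_mdp_def low_policy_def option_reward_expectation[OF assms] indicator_def)
  also have "\<dots> = expected_stage_reward (high_mdp M F) (high_policy F \<pi>) t"
    unfolding low_stopped_state bind expected_stage_reward_def split_beta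
    by (intro Bochner_Integration.integral_cong)
       (auto simp: f_def high_mdp_def indicator_def)
  finally show ?thesis .
qed

theorem proposition1:
  fixes M :: "('s::countable, 'a::countable) mdp"
    and F :: "('s, 'a, 'w::countable) option_family"
    and \<pi> :: "'s \<Rightarrow> 'w pmf"
  assumes "wf_mdp M"
    and "wf_option_family F"
    and "terminates_almost_surely M F \<pi>"
  shows "option_expected_return M F \<pi> = mdp_expected_return (high_mdp M F) (high_policy F \<pi>) \<and>
    mdp_expected_return (high_mdp M F) (high_policy F \<pi>) =
      mdp_expected_return (low_mdp M F \<pi>) (low_policy F)"
proof -
  let ?H = "high_mdp M F" and ?L = "low_mdp M F \<pi>"
  \<comment> \<open>Termination is assumed for option execution; the trajectory bijection carries it
    to the low-MDP.\<close>
  have "(mdp_traj_prob ?L (low_policy F) has_sum 1) (mdp_trajs ?L)"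
    using assms(3) unfolding terminates_almost_surely_def
    by (subst has_sum_reindex_bij_betw[OF bij_low_traj, symmetric]) (simp add: low_traj_prob)
  then have L: "(\<lambda>t. measure_pmf.prob (stopped_state ?L (low_policy F) t) (- terminal ?L)) \<longlonglongrightarrow> 0"
    by (rule nonterminal_prob_tendsto_0)
  then have H: "(\<lambda>t. measure_pmf.prob (stopped_state ?H (high_policy F \<pi>) t) (- terminal ?H)) \<longlonglongrightarrow> 0"
    by (simp add: low_terminal_prob)
  have "(\<lambda>t. discount M ^ t * expected_stage_reward ?H (high_policy F \<pi>) t) sums
      mdp_expected_return ?H (high_policy F \<pi>)"
    using expected_stage_reward_sums[OF wf_high_mdp[OF assms(1)] H] by (simp add: high_mdp_def)
  \<comment> \<open>With the stage rewards equal, one series has both expected returns as its sum,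
    so uniqueness of limits identifies them.\<close>
  moreover have "(\<lambda>t. discount M ^ t * expected_stage_reward ?H (high_policy F \<pi>) t) sums
      mdp_expected_return ?L (low_policy F)"
    using expected_stage_reward_sums[OF wf_low_mdp[OF assms(1)] L]
    unfolding low_expected_stage_reward[OF assms(1)] by (simp add: low_mdp_def)
  ultimately have "mdp_expected_return ?H (high_policy F \<pi>) = mdp_expected_return ?L (low_policy F)"
    by (rule sums_unique2)
  then show ?thesis
    by (simp add: low_expected_return)
qed

end
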